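(* Consider the popularity model described in the context with $\alpha_v=0$ (hence $\gamma_v=1-\beta_v$) for all $v\in\mathcal V$, i.e. for all $i\in\mathcal I$, $v\in\mathcal V$ and integers $t\ge 0$, $$x_v^{(i)}(t+1)=\beta_v\,\pi^{(i)}(t)+(1-\beta_v)\,q^{(i)} .$$ Let $q_{\mathrm{tot}}=\sum_{i\in\mathcal I}q^{(i)}$. Suppose that there exists $v\in\mathcal V$ with $\beta_v\neq 1$ and that there exists $i\in\mathcal I$ with $q^{(i)}>0$. Then, for any initial condition $\pi(0)=\pi_0$, for all $i\in\mathcal I$ and all $v\in\mathcal V$, $$\lim_{t\to\infty}\pi^{(i)}(t)=\frac{q^{(i)}}{q_{\mathrm{tot}}},\qquad \lim_{t\to\infty}x_v^{(i)}(t)=\beta_v\frac{q^{(i)}}{q_{\mathrm{tot}}}+(1-\beta_v)\,q^{(i)} .$$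
   Context: $\mathcal V$ is a finite set of $n\ge 1$ users and $\mathcal I$ is a finite nonempty set of influencers. For each user $v\in\mathcal V$ and influencer $i\in\mathcal I$, $x_v^{(i)}(t)\in[0,1]$ is the attention of $v$ to $i$ at time $t\in\{0,1,2,\dots\}$; $q^{(i)}\in[0,1]$ is the quality of influencer $i$; $\alpha_v,\beta_v,\gamma_v\ge 0$ are coefficients with $\alpha_v+\beta_v+\gamma_v=1$. The popularity of $i$ at time $t$ is $$\pi^{(i)}(t)=\frac{\sum_{v\in\mathcal V}x_v^{(i)}(t)}{\sum_{j\in\mathcal I}\sum_{w\in\mathcal V}x_w^{(j)}(t)} .$$ $P$ is an $n\times n$ row-stochastic matrix (nonnegative entries, rows summing to 1). The general model is $$x_v^{(i)}(t+1)=\alpha_v\sum_{w\in\mathcal V}P_{vw}x_w^{(i)}(t)+\beta_v\pi^{(i)}(t)+\gamma_vq^{(i)}.$$ The initial attentions $x^{(i)}_v(0)\in[0,1]$ are assumed not all zero, so that $\pi(0)=(\pi^{(i)}(0))_{i\in\mathcal I}$ is defined; it is a nonnegative vector with entries summing to 1. *)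

theory Defs
  imports "HOL-Analysis.Analysis"
begin

text \<open>
  The users are the elements of a finite type \<open>'v\<close> and the influencers the elements of a finite
  type \<open>'i\<close>; \<open>x v i t\<close> is the attention of user \<open>v\<close> to influencer \<open>i\<close> at time \<open>t\<close>.
\<close>

definition row_stochastic :: "real ^ 'n ^ 'n \<Rightarrow> bool" where
  "row_stochastic P \<longleftrightarrow> (\<forall>v w. 0 \<le> P $ v $ w) \<and> (\<forall>v. (\<Sum>w\<in>UNIV. P $ v $ w) = 1)"

definition popularity ::
    "('v::finite \<Rightarrow> 'i::finite \<Rightarrow> nat \<Rightarrow> real) \<Rightarrow> 'i \<Rightarrow> nat \<Rightarrow> real" where
  "popularity x i t = (\<Sum>v\<in>UNIV. x v i t) / (\<Sum>j\<in>UNIV. \<Sum>w\<in>UNIV. x w j t)"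

text \<open>
  Membership of the attentions in \<open>[0,1]\<close> is required at time 0 only: at later times the
  dynamics preserves it, since every step takes a convex combination of numbers in \<open>[0,1]\<close>.
\<close>

locale popularity_model =
  fixes P :: "real ^ 'v ^ 'v"
    and \<alpha> \<beta> \<gamma> :: "'v::finite \<Rightarrow> real"
    and q :: "'i::finite \<Rightarrow> real"
    and x :: "'v \<Rightarrow> 'i \<Rightarrow> nat \<Rightarrow> real"
  assumes stochastic: "row_stochastic P"
    and coeff_nonneg: "0 \<le> \<alpha> v" "0 \<le> \<beta> v" "0 \<le> \<gamma> v"
    and coeff_sum: "\<alpha> v + \<beta> v + \<gamma> v = 1"
    and quality: "q i \<in> {0..1}"
    and init_range: "x v i 0 \<in> {0..1}"
    and init_nonzero: "\<exists>v i. x v i 0 \<noteq> 0"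
    and dynamics: "x v i (Suc t) =
      \<alpha> v * (\<Sum>w\<in>UNIV. P $ v $ w * x w i t) + \<beta> v * popularity x i t + \<gamma> v * q i"

end

theory Submission
  imports Defs
begin

text \<open>
  Summing the dynamics over all users shows that, after one step, the total attention is the
  constant \<open>D = B + (n - B) q_tot > 0\<close> with \<open>B = \<Sum>v. \<beta> v\<close>. Hence the popularity of each influencer
  evolves by an affine map with slope \<open>B / D < 1\<close> and fixed point \<open>q i / q_tot\<close>.
\<close>

text \<open>The hypothesis excludes a genuine exception: with a zero total, division by 0 gives 0,
  so every popularity, and hence their sum, would be 0.\<close>

lemma sum_popularity:
  assumes "(\<Sum>j\<in>UNIV. \<Sum>w\<in>UNIV. x w j t) \<noteq> 0"
  shows "(\<Sum>i\<in>UNIV. popularity x i t) = 1"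
  using assms unfolding popularity_def by (simp flip: sum_divide_distrib)

context popularity_model
begin

text \<open>Base case for the induction showing that the total attention never vanishes, so that
  \<open>popularity\<close> is a true quotient at all times.\<close>

lemma initial_total_pos: "(\<Sum>i\<in>UNIV. \<Sum>v\<in>UNIV. x v i 0) > 0"
proof -
  obtain v i where "x v i 0 \<noteq> 0" using init_nonzero by blast
  moreover have nonneg: "0 \<le> x v i 0" for v i
    using init_range by simp
  ultimately have "0 < x v i 0"
    by (simp add: less_le)
  then have "(\<Sum>v\<in>UNIV. x v i 0) > 0"
    by (intro sum_pos2[of UNIV v]) (auto simp: nonneg)
  then show ?thesis
    by (intro sum_pos2[of UNIV i]) (auto simp: nonneg sum_nonneg)
qed

context
  assumes no_network: "\<And>v. \<alpha> v = 0"
begin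

lemma attention_Suc: "x v i (Suc t) = \<beta> v * popularity x i t + (1 - \<beta> v) * q i"
proof -
  have "\<gamma> v = 1 - \<beta> v"
    using coeff_sum[of v] no_network[of v] by simp
  then show ?thesis
    by (simp add: dynamics no_network)
qed

lemma influencer_total_Suc:
  "(\<Sum>v\<in>UNIV. x v i (Suc t)) = sum \<beta> UNIV * popularity x i t + (\<Sum>v\<in>UNIV. 1 - \<beta> v) * q i"
  by (simp only: attention_Suc sum.distrib sum_distrib_right)

text \<open>Since the popularities at time \<open>t\<close> sum to 1, summing
  \<open>influencer_total_Suc\<close> over the influencers removes the dependence on
  \<open>t\<close>.\<close>

lemma total_Suc:
  assumes "(\<Sum>i\<in>UNIV. \<Sum>v\<in>UNIV. x v i t) \<noteq> 0"
  shows "(\<Sum>i\<in>UNIV. \<Sum>v\<in>UNIV. x v i (Suc t)) = sum \<beta> UNIV + (\<Sum>v\<in>UNIV. 1 - \<beta> v) * sum q UNIV"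
  by (simp only: influencer_total_Suc sum.distrib sum_popularity[of x t, OF assms] mult_1_right
      flip: sum_distrib_left)

lemma popularity_tendsto:
  assumes "\<exists>v. \<beta> v \<noteq> 1" and "\<exists>i. q i > 0"
  shows "(\<lambda>t. popularity x i t) \<longlonglongrightarrow> q i / sum q UNIV"
proof -
  define B where "B = sum \<beta> UNIV"
  define C where "C = (\<Sum>v\<in>UNIV. 1 - \<beta> v)"
  define Q where "Q = sum q UNIV"
  define D where "D = B + C * Q"
  have le1: "\<beta> v \<le> 1" for v
    using coeff_sum[of v] coeff_nonneg[of v] by simp
  have B: "B \<ge> 0"
    unfolding B_def by (simp add: sum_nonneg coeff_nonneg)
  obtain v where "\<beta> v < 1"
    using assms(1) le1 by (auto simp: less_le)
  then have C: "C > 0"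
    unfolding C_def by (intro sum_pos2[of UNIV v]) (auto simp: le1)
  obtain j where "q j > 0"
    using assms(2) by blast
  then have Q: "Q > 0"
    unfolding Q_def using quality by (intro sum_pos2[of UNIV j]) auto
  \<comment> \<open>The gap \<open>D - B = C * Q\<close> is positive because some user has \<beta>
    below 1 and some quality is positive.\<close>
  have D: "D > 0" and BD: "B < D"
    using B C Q by (simp_all add: D_def add_nonneg_pos)
  \<comment> \<open>Induction is needed because \<open>total_Suc\<close> yields the value
    \<open>D\<close> only if the preceding total is nonzero.\<close>
  have total: "(\<Sum>i\<in>UNIV. \<Sum>v\<in>UNIV. x v i t) \<noteq> 0" for t
  proof (induction t)
    case 0
    then show ?case using initial_total_pos by simp
  next
    case (Suc t)
    show ?case using total_Suc[OF Suc.IH] D by (simp add: D_def B_def C_def Q_def)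
  qed
  have step: "popularity x i (Suc t) - q i / Q = B / D * (popularity x i t - q i / Q)" for t
  proof -
    have "popularity x i (Suc t) = (B * popularity x i t + C * q i) / D"
      unfolding popularity_def[of x i "Suc t"] total_Suc[OF total]
      by (simp only: influencer_total_Suc D_def B_def C_def Q_def)
    \<comment> \<open>This is \<open>C * Q = D - B\<close> multiplied by \<open>q i / Q\<close>; it
      expresses that \<open>q i / Q\<close> is fixed by the map p -> (B p + C q i) / D.\<close>
    moreover have "C * q i = D * (q i / Q) - B * (q i / Q)"
      using Q by (simp add: D_def field_simps)
    ultimately show ?thesis
      using D by (simp add: diff_divide_distrib add_divide_distrib right_diff_distrib)
  qed
  \<comment> \<open>This covers \<open>B = 0\<close> too: the factor is then 1 at time 0 and 0
    afterwards, so the limit is reached in one step.\<close>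
  have "popularity x i t - q i / Q = (B / D) ^ t * (popularity x i 0 - q i / Q)" for t
    by (induction t) (simp_all only: step power_0 power_Suc mult_1_left mult.assoc)
  then have closed: "popularity x i t = q i / Q + (B / D) ^ t * (popularity x i 0 - q i / Q)" for t
    by (simp add: algebra_simps)
  have "(\<lambda>t. (B / D) ^ t) \<longlonglongrightarrow> 0"
    using B D BD by (intro LIMSEQ_realpow_zero) simp_all
  then have "(\<lambda>t. q i / Q + (B / D) ^ t * (popularity x i 0 - q i / Q)) \<longlonglongrightarrow>
      q i / Q + 0 * (popularity x i 0 - q i / Q)"
    by (intro tendsto_add tendsto_mult tendsto_const)
  then show ?thesis
    by (simp add: Q_def flip: closed[unfolded Q_def])
qed

text \<open>By \<open>attention_Suc\<close>, the attention at time \<open>t + 1\<close> is a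
  continuous function of the popularity at time \<open>t\<close>, and shifting the index by one does
  not affect the limit.\<close>

lemma attention_tendsto:
  assumes "(\<lambda>t. popularity x i t) \<longlonglongrightarrow> p"
  shows "(\<lambda>t. x v i t) \<longlonglongrightarrow> \<beta> v * p + (1 - \<beta> v) * q i"
proof (rule LIMSEQ_imp_Suc)
  show "(\<lambda>t. x v i (Suc t)) \<longlonglongrightarrow> \<beta> v * p + (1 - \<beta> v) * q i"
    unfolding attention_Suc by (intro tendsto_intros assms)
qed

end

end

theorem theorem1:
  fixes P :: "real ^ 'v ^ 'v"
    and \<alpha> \<beta> \<gamma> :: "'v::finite \<Rightarrow> real"
    and q :: "'i::finite \<Rightarrow> real"
    and x :: "'v \<Rightarrow> 'i \<Rightarrow> nat \<Rightarrow> real"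
  assumes "popularity_model P \<alpha> \<beta> \<gamma> q x"
    and "\<forall>v. \<alpha> v = 0"
    and "\<exists>v. \<beta> v \<noteq> 1"
    and "\<exists>i. q i > 0"
  defines "q_tot \<equiv> \<Sum>i\<in>UNIV. q i"
  shows "\<forall>i v. (\<lambda>t. popularity x i t) \<longlonglongrightarrow> q i / q_tot \<and>
    (\<lambda>t. x v i t) \<longlonglongrightarrow> \<beta> v * (q i / q_tot) + (1 - \<beta> v) * q i"
proof -
  interpret popularity_model P \<alpha> \<beta> \<gamma> q x by fact
  have \<alpha>: "\<alpha> v = 0" for v
    using assms(2) by simp
  note lim = popularity_tendsto[OF \<alpha> assms(3,4), folded q_tot_def]
  show ?thesis
    by (intro allI conjI lim attention_tendsto[OF \<alpha>])
qed

end
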